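(* Let $\mathcal{J}$ be a partition of $\{1,\dots,n\}$, let $P_1(x)=\sum_{J\in\mathcal{J}}\|x_J\|$ on $\mathbb{R}^n$, let $P_2$ be a norm on $\mathbb{R}^n$ with $P_2\le \mu P_1$ for some $\mu\in[0,1)$, let $\sigma>0$, let $y\in\mathbb{R}^n$ satisfy $P_1(y)-P_2(y)\le\sigma$, and let $\xi\in\partial P_2(y)$. Let $a\in\mathbb{R}^n$ with $a\neq 0$ and consider the problem $$\min_{x\in\mathbb{R}^n}\ \langle a,x\rangle\quad\text{s.t.}\quad \sum_{J\in\mathcal{J}}\|x_J\|-\langle\xi,x\rangle\le\sigma.\qquad(\ast)$$ For each $J\in\mathcal{J}$, fix any vector $v_J\in\mathbb{R}^{|J|}$ with $\|v_J\|=1$ and define $$w_J^*=\begin{cases} v_J & \text{if } a_J=0,\\ \xi_J-\dfrac{\langle a_J,\xi_J\rangle+\sqrt{\langle a_J,\xi_J\rangle^2-\|a_J\|^2(\|\xi_J\|^2-1)}}{\|a_J\|^2}\,a_J & \text{otherwise.}\end{cases}$$ Let $\mathcal{I}:=\operatorname{Arg\,min}_{J\in\mathcal{J}}\{\kappa_J\}$, where $$\kappa_J:=\min_{\|w_J\|=1}\frac{\langle a_J,w_J\rangle}{1-\langle\xi_J,w_J\rangle},$$ and fix any $J_0\in\mathcal{I}$. Then a solution $x^*=(x_J^* )_{J\in\mathcal{J}}$ of $(\ast)$ is given by $$x_J^*=\begin{cases}\dfrac{\sigma w_{J_0}^*}{1-\langle\xi_{J_0},w_{J_0}^*\rangle}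 & \text{if } J=J_0,\\ 0 & \text{otherwise.}\end{cases}$$
   Context: $\|\cdot\|$ is the Euclidean norm and $\langle\cdot,\cdot\rangle$ the standard inner product. For $J\subseteq\{1,\dots,n\}$, $x_J\in\mathbb{R}^{|J|}$ denotes the subvector of $x\in\mathbb{R}^n$ indexed by $J$, and $|J|$ is the cardinality of $J$. $\partial P_2$ is the subdifferential of convex analysis. $\operatorname{Arg\,min}$ denotes the set of minimizers. *)

theory Defs
  imports "HOL-Analysis.Analysis" "HOL-Library.Disjoint_Sets"
begin

(* R^J is represented by the coordinate subspace of R^n of vectors vanishing outside J.
   The zero padding preserves inner products and Euclidean norms. *)

definition block_space :: "'n::finite set \<Rightarrow> (real ^ 'n) set" where
  "block_space J = {w. \<forall>i. i \<notin> J \<longrightarrow> w $ i = 0}"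

definition subvec :: "real ^ 'n::finite \<Rightarrow> 'n set \<Rightarrow> real ^ 'n" where
  "subvec x J = (\<chi> i. if i \<in> J then x $ i else 0)"

definition block_sphere :: "'n::finite set \<Rightarrow> (real ^ 'n) set" where
  "block_sphere J = {w \<in> block_space J. norm w = 1}"

definition group_norm :: "'n::finite set set \<Rightarrow> real ^ 'n \<Rightarrow> real" where
  "group_norm \<J> x = (\<Sum>J\<in>\<J>. norm (subvec x J))"

definition is_norm :: "('a::real_vector \<Rightarrow> real) \<Rightarrow> bool" where
  "is_norm p \<longleftrightarrow>
     (\<forall>x. 0 \<le> p x) \<and> (\<forall>x. p x = 0 \<longleftrightarrow> x = 0) \<and>
     (\<forall>c x. p (c *\<^sub>R x) = \<bar>c\<bar> * p x) \<and>
     (\<forall>x y. p (x + y) \<le> p x + p y)"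

definition subdifferential :: "('a::real_inner \<Rightarrow> real) \<Rightarrow> 'a \<Rightarrow> 'a set" where
  "subdifferential f y = {\<xi>. \<forall>z. f z \<ge> f y + \<xi> \<bullet> (z - y)}"

(* LEAST is the minimum of the set of values, not its infimum:
   it is specified only if the minimum is attained. *)
definition kappa :: "real ^ 'n::finite \<Rightarrow> real ^ 'n \<Rightarrow> 'n set \<Rightarrow> real" where
  "kappa a \<xi> J =
     (LEAST c. c \<in> (\<lambda>w. (subvec a J \<bullet> w) / (1 - subvec \<xi> J \<bullet> w)) ` block_sphere J)"

definition w_star ::
    "real ^ 'n::finite \<Rightarrow> real ^ 'n \<Rightarrow> ('n set \<Rightarrow> real ^ 'n) \<Rightarrow> 'n set \<Rightarrow> real ^ 'n" where
  "w_star a \<xi> v J =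
     (let aJ = subvec a J; \<xi>J = subvec \<xi> J in
      if aJ = 0 then v J
      else \<xi>J - ((aJ \<bullet> \<xi>J + sqrt ((aJ \<bullet> \<xi>J)\<^sup>2 - (norm aJ)\<^sup>2 * ((norm \<xi>J)\<^sup>2 - 1)))
                 / (norm aJ)\<^sup>2) *\<^sub>R aJ)"

(* Since the blocks are zero-padded, a vector is the sum of its blocks. *)
definition x_star ::
    "'n::finite set set \<Rightarrow> real \<Rightarrow> real ^ 'n \<Rightarrow> real ^ 'n \<Rightarrow> ('n set \<Rightarrow> real ^ 'n) \<Rightarrow> 'n set
      \<Rightarrow> real ^ 'n" where
  "x_star \<J> \<sigma> a \<xi> v J0 =
     (\<Sum>J\<in>\<J>. if J = J0
        then (\<sigma> / (1 - subvec \<xi> J0 \<bullet> w_star a \<xi> v J0)) *\<^sub>R w_star a \<xi> v J0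
        else 0)"

end

theory Submission
  imports Defs
begin

text \<open>
  Why the solution is concentrated on one block. A subgradient \<open>\<xi>\<close> of a norm satisfies
  \<open>\<xi> \<bullet> z \<le> P2 z\<close> for every \<open>z\<close>, so \<open>P2 \<le> \<mu> P1\<close> with \<open>\<mu> < 1\<close> forces
  \<open>\<parallel>\<xi>\<^sub>J\<parallel> < 1\<close> on every block (\<open>norm_subvec_subgradient_less_1\<close>). Hence the constraint function
  splits into the nonnegative, positively homogeneous block costs \<open>\<parallel>x\<^sub>J\<parallel> - \<xi>\<^sub>J \<bullet> x\<^sub>J\<close>, and \<open>\<kappa>\<^sub>J\<close> is the
  least objective value that one unit of cost can buy in block \<open>J\<close>. Some \<open>a\<^sub>J\<close> is nonzero, so
  the best rate \<open>\<kappa>\<close> is negative. Summing \<open>a\<^sub>J \<bullet> x\<^sub>J \<ge> \<kappa>\<^sub>J (\<parallel>x\<^sub>J\<parallel> - \<xi>\<^sub>J \<bullet> x\<^sub>J)\<close> over the blocks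
  gives \<open>a \<bullet> x \<ge> \<kappa> \<sigma>\<close> for feasible \<open>x\<close>, and equality holds when the entire budget \<open>\<sigma>\<close> is spent in a
  best block along a direction attaining \<open>\<kappa>\<close>.

  The formula for that direction comes from Cauchy-Schwarz. Fix a block with \<open>a\<^sub>J \<noteq> 0\<close> and
  write \<open>g = a\<^sub>J\<close>, \<open>s = \<xi>\<^sub>J\<close>. For \<open>t > 0\<close>, the bound \<open>(g \<bullet> w) / (1 - s \<bullet> w) \<ge> -1/t\<close> rearranges to
  \<open>(s - t g) \<bullet> w \<le> 1\<close>. This holds on the whole unit sphere, with equality at
  \<open>w = s - t g\<close>, once \<open>t\<close> is chosen such that \<open>s - t g\<close> is itself a unit vector. That is a
  quadratic equation for \<open>t\<close>, and its positive root gives \<open>w\<^sub>J\<^sup>*\<close> (\<open>w_star_minimizes\<close>).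
\<close>

section \<open>Zero-padded blocks\<close>

lemma subvec_in_block_space: "subvec x J \<in> block_space J"
  by (simp add: subvec_def block_space_def)

lemma subvec_block_space:
  assumes "x \<in> block_space J"
  shows "subvec x J = x"
  using assms by (auto simp: subvec_def block_space_def vec_eq_iff)

lemma subvec_block_space_disjoint:
  assumes "x \<in> block_space I" and "I \<inter> J = {}"
  shows "subvec x J = 0"
  using assms by (auto simp: subvec_def block_space_def vec_eq_iff)

lemma inner_subvec_subvec: "subvec x J \<bullet> subvec z J = x \<bullet> subvec z J"
  by (auto simp: subvec_def inner_vec_def intro!: sum.cong)

lemma inner_subvec_block_space:
  assumes "w \<in> block_space J"
  shows "subvec x J \<bullet> w = x \<bullet> w"
  using inner_subvec_subvec[of x J w] assms by (simp add: subvec_block_space)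

lemma sum_subvec:
  fixes x :: "real ^ 'n::finite"
  assumes "partition_on UNIV \<J>"
  shows "(\<Sum>J\<in>\<J>. subvec x J) = x"
proof -
  have "(\<Sum>J\<in>\<J>. subvec x J) $ i = x $ i" for i
  proof -
    obtain J where J: "J \<in> \<J>" "i \<in> J"
      using partition_onD1[OF assms] by blast
    have "i \<in> I \<longleftrightarrow> I = J" if "I \<in> \<J>" for I
      using partition_onD2[OF assms] J that unfolding disjoint_def by blast
    then have "(\<Sum>I\<in>\<J>. subvec x I) $ i = (\<Sum>I\<in>\<J>. if I = J then x $ i else 0)"
      unfolding sum_component by (intro sum.cong) (simp_all add: subvec_def)
    then show ?thesis using J by simp
  qed
  then show ?thesis by (simp add: vec_eq_iff)
qed

lemma inner_eq_sum_subvec: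
  assumes "partition_on UNIV \<J>"
  shows "x \<bullet> z = (\<Sum>J\<in>\<J>. subvec x J \<bullet> subvec z J)"
proof -
  have "x \<bullet> z = x \<bullet> (\<Sum>J\<in>\<J>. subvec z J)"
    using sum_subvec[OF assms] by simp
  also have "\<dots> = (\<Sum>J\<in>\<J>. subvec x J \<bullet> subvec z J)"
    by (simp add: inner_sum_right inner_subvec_subvec)
  finally show ?thesis .
qed

lemma group_norm_block_space:
  assumes "partition_on UNIV \<J>" and "J \<in> \<J>" and "x \<in> block_space J"
  shows "group_norm \<J> x = norm x"
proof -
  have "norm (subvec x I) = (if I = J then norm x else 0)" if "I \<in> \<J>" for I
  proof (cases "I = J")
    case True
    then show ?thesis using assms by (simp add: subvec_block_space)
  next
    case False
    then have "J \<inter> I = {}"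
      using assms(1,2) that by (auto simp: partition_on_def disjoint_def)
    with False assms(3) show ?thesis by (simp add: subvec_block_space_disjoint)
  qed
  then show ?thesis
    unfolding group_norm_def using assms(2) by simp
qed

section \<open>Subgradients of a norm\<close>

text \<open>
  Test the subgradient inequality at \<open>y + z\<close>; subadditivity removes the dependence on \<open>y\<close>.
\<close>

lemma subgradient_inner_le:
  assumes "\<And>x z. p (x + z) \<le> p x + p z" and "\<xi> \<in> subdifferential p y"
  shows "\<xi> \<bullet> z \<le> p z"
proof -
  have "p y + \<xi> \<bullet> (y + z - y) \<le> p (y + z)"
    using assms(2) unfolding subdifferential_def by blast
  with assms(1)[of y z] show ?thesis by simp
qed

text \<open>
  The functional \<open>z \<mapsto> \<xi> \<bullet> z\<close> is bounded by \<open>\<mu> \<parallel>z\<parallel>\<close> on the block \<open>J\<close>; its value at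
  \<open>z = \<xi>\<^sub>J\<close> is \<open>\<parallel>\<xi>\<^sub>J\<parallel>\<^sup>2\<close>.
\<close>

lemma norm_subvec_subgradient_less_1:
  assumes "partition_on UNIV \<J>" and "J \<in> \<J>"
    and "is_norm P" and "\<mu> < 1" and "\<And>x. P x \<le> \<mu> * group_norm \<J> x"
    and "\<xi> \<in> subdifferential P y"
  shows "norm (subvec \<xi> J) < 1"
proof (cases "subvec \<xi> J = 0")
  case False
  let ?s = "subvec \<xi> J"
  have "norm ?s * norm ?s = \<xi> \<bullet> ?s"
    unfolding inner_subvec_subvec[of \<xi> J \<xi>, symmetric]
    by (simp add: dot_square_norm power2_eq_square)
  also have "\<dots> \<le> P ?s"
    using assms(3,6) by (intro subgradient_inner_le) (auto simp: is_norm_def)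
  also have "\<dots> \<le> \<mu> * group_norm \<J> ?s"
    by (rule assms(5))
  also have "group_norm \<J> ?s = norm ?s"
    by (rule group_norm_block_space[OF assms(1,2) subvec_in_block_space])
  finally show ?thesis using False assms(4) by simp
qed simp

section \<open>The linear-fractional problem on the unit sphere\<close>

lemma inner_less_1:
  fixes s w :: "'a::real_inner"
  assumes "norm s < 1" and "norm w = 1"
  shows "s \<bullet> w < 1"
  using norm_cauchy_schwarz[of s w] assms by simp

text \<open>
  The number \<open>t\<close> is the larger root of \<open>\<parallel>s - t g\<parallel>\<^sup>2 = 1\<close>. As \<open>s\<close> lies strictly inside the unit
  ball, the product of the roots is negative, hence this root is positive.
\<close>

lemma sphere_hitting_time:
  fixes g s :: "'a::real_inner"
  assumes "g \<noteq> 0" and "norm s < 1"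
  defines "t \<equiv> (g \<bullet> s + sqrt ((g \<bullet> s)\<^sup>2 - (norm g)\<^sup>2 * ((norm s)\<^sup>2 - 1))) / (norm g)\<^sup>2"
  shows "0 < t" and "norm (s - t *\<^sub>R g) = 1"
proof -
  define b where "b = g \<bullet> s"
  define G where "G = (norm g)\<^sup>2"
  define D where "D = b\<^sup>2 - G * ((norm s)\<^sup>2 - 1)"
  have t: "t = (b + sqrt D) / G"
    by (simp add: t_def b_def G_def D_def)
  have G: "G > 0" using assms(1) by (simp add: G_def)
  have "(norm s)\<^sup>2 < 1" using assms(2) by (simp add: power_less_one_iff)
  then have "G * ((norm s)\<^sup>2 - 1) < 0" using G by (simp add: mult_pos_neg)
  then have D: "b\<^sup>2 < D" by (simp add: D_def)
  then have "sqrt (b\<^sup>2) < sqrt D" by (rule real_sqrt_less_mono)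
  then have "b + sqrt D > 0" by simp
  with G show "0 < t" by (simp add: t)
  have "D \<ge> 0" using D zero_le_power2[of b] by linarith
  moreover have "G * t - b = sqrt D" using G by (simp add: t)
  ultimately have "(G * t - b)\<^sup>2 = D" by simp
  then have "G * (G * t\<^sup>2 - 2 * t * b + (norm s)\<^sup>2 - 1) = 0"
    by (simp add: D_def power2_eq_square algebra_simps)
  then have "G * t\<^sup>2 - 2 * t * b + (norm s)\<^sup>2 = 1" using G by simp
  moreover have "(norm (s - t *\<^sub>R g))\<^sup>2 = G * t\<^sup>2 - 2 * t * b + (norm s)\<^sup>2"
    unfolding G_def b_def power2_norm_eq_inner
    by (simp add: inner_diff_left inner_diff_right inner_commute power2_eq_square algebra_simps)
  ultimately have "(norm (s - t *\<^sub>R g))\<^sup>2 = 1" by simp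
  then show "norm (s - t *\<^sub>R g) = 1"
    by (simp add: power2_eq_1_iff) (use norm_ge_zero[of "s - t *\<^sub>R g"] in linarith)
qed

lemma linear_fractional_ge:
  fixes g s w :: "'a::real_inner"
  assumes "norm s < 1" and "0 < t" and "norm (s - t *\<^sub>R g) = 1" and "norm w = 1"
  shows "- 1 / t \<le> (g \<bullet> w) / (1 - s \<bullet> w)"
proof -
  have "(s - t *\<^sub>R g) \<bullet> w \<le> 1"
    using norm_cauchy_schwarz[of "s - t *\<^sub>R g" w] assms by simp
  then have "- (1 - s \<bullet> w) \<le> t * (g \<bullet> w)"
    by (simp add: inner_diff_left)
  then show ?thesis
    using assms(2) inner_less_1[OF assms(1,4)] by (simp add: field_simps)
qed

lemma linear_fractional_attained:
  fixes g s :: "'a::real_inner"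
  assumes "norm s < 1" and "0 < t" and "norm (s - t *\<^sub>R g) = 1"
  shows "(g \<bullet> (s - t *\<^sub>R g)) / (1 - s \<bullet> (s - t *\<^sub>R g)) = - 1 / t"
proof -
  let ?w = "s - t *\<^sub>R g"
  have "?w \<bullet> ?w = 1" using assms(3) by (simp add: norm_eq_1)
  then have "t * (g \<bullet> ?w) = - (1 - s \<bullet> ?w)"
    by (simp add: inner_diff_left)
  then show ?thesis
    using assms(2) inner_less_1[OF assms(1,3)] by (simp add: field_simps)
qed

section \<open>The value and the minimizer of one block\<close>

text \<open>
  The negativity claim expresses that every block with \<open>a\<^sub>J \<noteq> 0\<close> can lower the objective: its
  minimum is \<open>-1/t\<close> with \<open>t > 0\<close>. If \<open>a\<^sub>J = 0\<close>, the quotient vanishes identically and every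
  unit vector of the block is a minimizer.
\<close>

lemma w_star_minimizes:
  fixes a \<xi> :: "real ^ 'n::finite"
  assumes "norm (subvec \<xi> J) < 1" and "v J \<in> block_sphere J"
  defines "w \<equiv> w_star a \<xi> v J"
    and "r \<equiv> \<lambda>w. (subvec a J \<bullet> w) / (1 - subvec \<xi> J \<bullet> w)"
  shows "w \<in> block_sphere J" (is ?sphere)
    and "\<And>u. u \<in> block_sphere J \<Longrightarrow> r w \<le> r u" (is "\<And>u. _ \<Longrightarrow> ?min u")
    and "subvec a J \<noteq> 0 \<Longrightarrow> r w < 0" (is "_ \<Longrightarrow> ?neg")
proof -
  let ?g = "subvec a J" and ?s = "subvec \<xi> J"
  have "?sphere \<and> (\<forall>u \<in> block_sphere J. ?min u) \<and> (?g \<noteq> 0 \<longrightarrow> ?neg)"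
  proof (cases "?g = 0")
    case True
    then show ?thesis using assms(2) by (simp add: w_def w_star_def r_def)
  next
    case False
    define t where "t = (?g \<bullet> ?s + sqrt ((?g \<bullet> ?s)\<^sup>2 - (norm ?g)\<^sup>2 * ((norm ?s)\<^sup>2 - 1)))
                         / (norm ?g)\<^sup>2"
    have w: "w = ?s - t *\<^sub>R ?g"
      using False by (simp add: w_def w_star_def t_def Let_def)
    have t: "0 < t" and unit: "norm (?s - t *\<^sub>R ?g) = 1"
      using sphere_hitting_time[OF False assms(1)] by (simp_all add: t_def)
    have "r w = - 1 / t"
      unfolding r_def w by (rule linear_fractional_attained[OF assms(1) t unit])
    moreover have "- 1 / t \<le> r u" if "u \<in> block_sphere J" for u
      using linear_fractional_ge[OF assms(1) t unit] that
      by (simp add: r_def block_sphere_def)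
    moreover have "w \<in> block_space J"
      by (simp add: w block_space_def subvec_def)
    ultimately show ?thesis
      using t unit by (simp add: block_sphere_def w)
  qed
  then show ?sphere "\<And>u. u \<in> block_sphere J \<Longrightarrow> ?min u" "?g \<noteq> 0 \<Longrightarrow> ?neg"
    by blast+
qed

lemma kappa_eq_w_star:
  assumes "norm (subvec \<xi> J) < 1" and "v J \<in> block_sphere J"
  shows "kappa a \<xi> J =
    (subvec a J \<bullet> w_star a \<xi> v J) / (1 - subvec \<xi> J \<bullet> w_star a \<xi> v J)"
  unfolding kappa_def
  using w_star_minimizes(1,2)[where v = v, OF assms] by (intro Least_equality) blast+

text \<open>
  Both sides are positively homogeneous in \<open>x\<close>, so the bound on the unit sphere that defines \<open>\<kappa>\<^sub>J\<close>
  extends to the whole block. The unit vector \<open>v J\<close> guarantees that the sphere is nonempty, so that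
  the minimum exists.
\<close>

lemma kappa_mult_cost_le:
  assumes "norm (subvec \<xi> J) < 1" and "v J \<in> block_sphere J" and "x \<in> block_space J"
  shows "kappa a \<xi> J * (norm x - subvec \<xi> J \<bullet> x) \<le> subvec a J \<bullet> x"
proof (cases "x = 0")
  case False
  define u where "u = x /\<^sub>R norm x"
  have u: "u \<in> block_sphere J"
    using assms(3) False by (simp add: u_def block_sphere_def block_space_def)
  have "norm u = 1"
    using u by (simp add: block_sphere_def)
  then have pos: "0 < 1 - subvec \<xi> J \<bullet> u"
    using inner_less_1[OF assms(1)] by simp
  have "kappa a \<xi> J \<le> (subvec a J \<bullet> u) / (1 - subvec \<xi> J \<bullet> u)"
    unfolding kappa_eq_w_star[where v = v, OF assms(1,2)]
    by (rule w_star_minimizes(2)[where v = v, OF assms(1,2) u])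
  then have "kappa a \<xi> J * (1 - subvec \<xi> J \<bullet> u) \<le> subvec a J \<bullet> u"
    using pos by (simp add: pos_le_divide_eq)
  then have "norm x * (kappa a \<xi> J * (1 - subvec \<xi> J \<bullet> u)) \<le> norm x * (subvec a J \<bullet> u)"
    by (intro mult_left_mono) auto
  moreover have "norm x * (1 - subvec \<xi> J \<bullet> u) = norm x - subvec \<xi> J \<bullet> x"
    using False by (simp add: right_diff_distrib u_def)
  moreover have "norm x * (subvec a J \<bullet> u) = subvec a J \<bullet> x"
    using False by (simp add: u_def)
  ultimately show ?thesis by (metis mult.left_commute)
qed simp

section \<open>Spending the whole budget in a best block\<close>

theorem theorem1:
  fixes \<J> :: "'n::finite set set"
    and P2 :: "real ^ 'n \<Rightarrow> real"
    and \<mu> \<sigma> :: real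
    and y \<xi> a :: "real ^ 'n"
    and v :: "'n set \<Rightarrow> real ^ 'n"
    and J0 :: "'n set"
  assumes "partition_on UNIV \<J>"
    and "is_norm P2"
    and "0 \<le> \<mu>" and "\<mu> < 1"
    and "\<And>x. P2 x \<le> \<mu> * group_norm \<J> x"
    and "\<sigma> > 0"
    and "group_norm \<J> y - P2 y \<le> \<sigma>"
    and "\<xi> \<in> subdifferential P2 y"
    and "a \<noteq> 0"
    and "\<And>J. J \<in> \<J> \<Longrightarrow> v J \<in> block_sphere J"
    and "is_arg_min (kappa a \<xi>) (\<lambda>J. J \<in> \<J>) J0"
  shows "is_arg_min (\<lambda>x. a \<bullet> x)
           (\<lambda>x. (\<Sum>J\<in>\<J>. norm (subvec x J)) - \<xi> \<bullet> x \<le> \<sigma>)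
           (x_star \<J> \<sigma> a \<xi> v J0)"
proof -
  note part = assms(1) and sphere = assms(10)
  have small: "norm (subvec \<xi> J) < 1" if "J \<in> \<J>" for J
    by (rule norm_subvec_subgradient_less_1[OF part that assms(2,4,5,8)])
  have J0: "J0 \<in> \<J>" and best: "\<And>J. J \<in> \<J> \<Longrightarrow> kappa a \<xi> J0 \<le> kappa a \<xi> J"
    using assms(11) by (auto simp: is_arg_min_linorder)
  define \<kappa> where "\<kappa> = kappa a \<xi> J0"

  have "\<kappa> < 0"
  proof -
    obtain J where J: "J \<in> \<J>" "subvec a J \<noteq> 0"
      using sum_subvec[OF part, of a] assms(9) by (metis sum.neutral)
    have "kappa a \<xi> J < 0"
      unfolding kappa_eq_w_star[where v = v, OF small[OF J(1)] sphere[OF J(1)]]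
      by (rule w_star_minimizes(3)[where v = v, OF small[OF J(1)] sphere[OF J(1)] J(2)])
    with best[OF J(1)] show ?thesis by (simp add: \<kappa>_def)
  qed

  define w where "w = w_star a \<xi> v J0"
  define c where "c = \<sigma> / (1 - subvec \<xi> J0 \<bullet> w)"
  define x where "x = x_star \<J> \<sigma> a \<xi> v J0"
  have w: "w \<in> block_space J0" "norm w = 1"
    using w_star_minimizes(1)[where v = v, OF small[OF J0] sphere[OF J0]]
    by (auto simp: w_def block_sphere_def)
  have x: "x = c *\<^sub>R w"
    using J0 by (simp add: x_def x_star_def c_def w_def)
  have pos: "0 < 1 - subvec \<xi> J0 \<bullet> w"
    using inner_less_1[OF small[OF J0] w(2)] by simp
  then have "0 < c"
    using assms(6) by (simp add: c_def)

  have feasible: "group_norm \<J> x - \<xi> \<bullet> x = \<sigma>"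
  proof -
    have "x \<in> block_space J0"
      using w(1) by (simp add: x block_space_def)
    then have "group_norm \<J> x = c"
      using group_norm_block_space[OF part J0] \<open>0 < c\<close> w(2) by (simp add: x)
    moreover have "\<xi> \<bullet> x = c * (subvec \<xi> J0 \<bullet> w)"
      using w(1) by (simp add: x inner_subvec_block_space)
    ultimately have "group_norm \<J> x - \<xi> \<bullet> x = c * (1 - subvec \<xi> J0 \<bullet> w)"
      by (simp add: right_diff_distrib)
    then show ?thesis
      using pos by (simp add: c_def)
  qed

  have "\<kappa> = (subvec a J0 \<bullet> w) / (1 - subvec \<xi> J0 \<bullet> w)"
    unfolding \<kappa>_def w_def by (rule kappa_eq_w_star[where v = v, OF small[OF J0] sphere[OF J0]])
  then have objective: "a \<bullet> x = \<kappa> * \<sigma>"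
    using w(1) by (simp add: x c_def inner_subvec_block_space)

  have lower: "\<kappa> * \<sigma> \<le> a \<bullet> z" if z: "group_norm \<J> z - \<xi> \<bullet> z \<le> \<sigma>" for z
  proof -
    let ?cost = "\<lambda>J. norm (subvec z J) - subvec \<xi> J \<bullet> subvec z J"
    have total: "group_norm \<J> z - \<xi> \<bullet> z = (\<Sum>J\<in>\<J>. ?cost J)"
      by (simp only: group_norm_def inner_eq_sum_subvec[OF part, of \<xi> z] sum_subtractf)
    have block: "\<kappa> * ?cost J \<le> subvec a J \<bullet> subvec z J" if J: "J \<in> \<J>" for J
    proof -
      have "subvec \<xi> J \<bullet> subvec z J \<le> norm (subvec \<xi> J) * norm (subvec z J)"
        by (rule norm_cauchy_schwarz)
      also have "\<dots> \<le> norm (subvec z J)"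
        using small[OF J] by (intro mult_left_le_one_le) auto
      finally have "0 \<le> ?cost J" by simp
      then have "\<kappa> * ?cost J \<le> kappa a \<xi> J * ?cost J"
        using best[OF J] by (intro mult_right_mono) (simp_all add: \<kappa>_def)
      also have "\<dots> \<le> subvec a J \<bullet> subvec z J"
        by (rule kappa_mult_cost_le[where v = v, OF small[OF J] sphere[OF J] subvec_in_block_space])
      finally show ?thesis .
    qed
    \<comment> \<open>The rate is negative, so a point that leaves part of the budget unspent only loses.\<close>
    have "\<kappa> * \<sigma> \<le> \<kappa> * (group_norm \<J> z - \<xi> \<bullet> z)"
      using z \<open>\<kappa> < 0\<close> by (intro mult_left_mono_neg) auto
    also have "\<dots> = (\<Sum>J\<in>\<J>. \<kappa> * ?cost J)"
      by (simp only: total sum_distrib_left)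
    also have "\<dots> \<le> (\<Sum>J\<in>\<J>. subvec a J \<bullet> subvec z J)"
      by (intro sum_mono block)
    also have "\<dots> = a \<bullet> z"
      by (rule inner_eq_sum_subvec[OF part, symmetric])
    finally show ?thesis .
  qed

  show ?thesis
    using feasible objective lower
    unfolding x_def[symmetric] is_arg_min_linorder group_norm_def by simp
qed

end
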